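(* Let $\mathbb{H}=\mathbb{R}^3$ be the Heisenberg group with gauge $\|\cdot\|$, distance $d(x,y)=\|x^{-1}y\|$ and horizontal vector fields $X_1,X_2$ as in the context, and let $T>0$. Consider $$b(t,x)=X_1(x)+a(t,x)X_2(x),\qquad a(t,x)=\|(t,0,0)^{-1}x\|=\Big(\big(|x_1-t|^2+|x_2|^2\big)^2+|x_3-tx_2|^2\Big)^{1/4},$$ for $(t,x)\in[0,T]\times\mathbb{H}$. Then $a(t,\cdot)$ is $1$-Lipschitz with respect to $d$ for every $t\in[0,T]$ (so $b$ is a time-dependent Lipschitz horizontal vector field), and the Cauchy problem $$\dot\gamma(t)=b(t,\gamma(t)),\ t\in[0,T],\qquad\gamma(0)=0,$$ has, besides the solution $\gamma(t)=(t,0,0)$, at least one other solution on $[0,T]$ different from it.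
   Context: The Heisenberg group $\mathbb{H}$ is $\mathbb{R}^3$ with the operation $(x_1,x_2,x_3)(y_1,y_2,y_3)=(x_1+y_1,x_2+y_2,x_3+y_3+(x_1y_2-x_2y_1))$. The gauge is $\|(x_1,x_2,x_3)\|=\big((|x_1|^2+|x_2|^2)^2+|x_3|^2\big)^{1/4}$; $d(x,y)=\|x^{-1}y\|$ is a left-invariant distance. The vector fields are $X_1=\partial_1-x_2\partial_3$ and $X_2=\partial_2+x_1\partial_3$. A solution on $[0,T]$ is a continuous curve $\gamma:[0,T]\to\mathbb{H}$ with $\gamma(t)=\gamma(0)+\int_0^tb(s,\gamma(s))\,ds$ for every $t\in[0,T]$ (in coordinates of $\mathbb{R}^3$). *)

theory Defs
  imports "HOL-Analysis.Analysis"
begin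

type_synonym heis = "real ^ 3"

definition hmult :: "heis \<Rightarrow> heis \<Rightarrow> heis" where
  "hmult x y = vector [x $ 1 + y $ 1, x $ 2 + y $ 2, x $ 3 + y $ 3 + (x $ 1 * y $ 2 - x $ 2 * y $ 1)]"

definition hinv :: "heis \<Rightarrow> heis" where
  "hinv x = vector [- (x $ 1), - (x $ 2), - (x $ 3)]"

lemma hmult_assoc: "hmult (hmult x y) z = hmult x (hmult y z)"
  by (simp add: hmult_def vec_eq_iff forall_3 vector_3 algebra_simps)

lemma hmult_zero: "hmult 0 x = x" "hmult x 0 = x"
  by (simp_all add: hmult_def vec_eq_iff forall_3 vector_3)

lemma hmult_hinv: "hmult (hinv x) x = 0" "hmult x (hinv x) = 0"
  by (simp_all add: hmult_def hinv_def vec_eq_iff forall_3 vector_3)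

definition gauge_norm :: "heis \<Rightarrow> real" where
  "gauge_norm x = root 4 ((\<bar>x $ 1\<bar>\<^sup>2 + \<bar>x $ 2\<bar>\<^sup>2)\<^sup>2 + \<bar>x $ 3\<bar>\<^sup>2)"

definition hdist :: "heis \<Rightarrow> heis \<Rightarrow> real" where
  "hdist x y = gauge_norm (hmult (hinv x) y)"

text \<open>Vector fields are given by their coefficients with respect to the coordinate fields of
  \<open>\<real>\<^sup>3\<close>.\<close>

definition X1 :: "heis \<Rightarrow> heis" where
  "X1 x = vector [1, 0, - (x $ 2)]"

definition X2 :: "heis \<Rightarrow> heis" where
  "X2 x = vector [0, 1, x $ 1]"

text \<open>Lipschitz continuity with respect to \<^const>\<open>hdist\<close>, not the Euclidean distance used by
  \<^const>\<open>lipschitz_on\<close>.\<close>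

definition hlipschitz :: "real \<Rightarrow> (heis \<Rightarrow> real) \<Rightarrow> bool" where
  "hlipschitz L f \<longleftrightarrow> (\<forall>x y. \<bar>f x - f y\<bar> \<le> L * hdist x y)"

definition lipschitz_horizontal_field :: "real \<Rightarrow> (real \<Rightarrow> heis \<Rightarrow> heis) \<Rightarrow> bool" where
  "lipschitz_horizontal_field T b \<longleftrightarrow>
    (\<exists>a1 a2 L. \<forall>t\<in>{0..T}.
        hlipschitz L (a1 t) \<and> hlipschitz L (a2 t) \<and>
        (\<forall>x. b t x = a1 t x *\<^sub>R X1 x + a2 t x *\<^sub>R X2 x))"

text \<open>Values of the curve outside \<open>[0, T]\<close> are irrelevant. The integral is the Lebesgue
  integral: \<open>integral\<close> of an absolutely integrable function.\<close>

definition is_solution :: "real \<Rightarrow> (real \<Rightarrow> heis \<Rightarrow> heis) \<Rightarrow> (real \<Rightarrow> heis) \<Rightarrow> bool" where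
  "is_solution T b \<gamma> \<longleftrightarrow>
    continuous_on {0..T} \<gamma> \<and>
    (\<lambda>s. b s (\<gamma> s)) absolutely_integrable_on {0..T} \<and>
    (\<forall>t\<in>{0..T}. \<gamma> t = \<gamma> 0 + integral {0..t} (\<lambda>s. b s (\<gamma> s)))"

definition cauchy_solution :: "real \<Rightarrow> (real \<Rightarrow> heis \<Rightarrow> heis) \<Rightarrow> heis \<Rightarrow> (real \<Rightarrow> heis) \<Rightarrow> bool" where
  "cauchy_solution T b p \<gamma> \<longleftrightarrow> is_solution T b \<gamma> \<and> \<gamma> 0 = p"

definition coeff_a :: "real \<Rightarrow> heis \<Rightarrow> real" where
  "coeff_a t x = gauge_norm (hmult (hinv (vector [t, 0, 0])) x)"

definition field_b :: "real \<Rightarrow> heis \<Rightarrow> heis" where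
  "field_b t x = X1 x + coeff_a t x *\<^sub>R X2 x"

end

(* Along a solution starting at 0 one has x1 = t, and with y = x2, u = t x2 - x3 the Cauchy problem
   becomes the autonomous system y' = (y^4 + u^2)^(1/4), u' = 2 y with zero initial data. Its
   right-hand side is not Lipschitz at the origin but is monotone on y, u >= 0. The Picard operator
   therefore preserves order; it has the subsolution y = t^3/18 (from y' >= u^(1/2), the scaling
   y ~ t^3, u ~ t^4) and the supersolution y = exp (2 t), so that the iterates started from the
   subsolution increase to a fixed point with y >= t^3/18, which is not the line (t,0,0). *)

theory Submission
  imports Defs
begin

section \<open>The gauge distance\<close>

text \<open>With \<open>z = x\<^sub>1 + i x\<^sub>2\<close> the gauge is the square root of the modulus of \<open>|z|\<^sup>2 + i x\<^sub>3\<close>, and the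
  group law adds to these complex numbers a cross term of modulus at most \<open>2 |z| |z'|\<close>.\<close>

lemma gauge_norm_power2:
  "(gauge_norm x)\<^sup>2 = cmod (Complex ((x $ 1)\<^sup>2 + (x $ 2)\<^sup>2) (x $ 3))"
proof -
  define A where "A = ((x $ 1)\<^sup>2 + (x $ 2)\<^sup>2)\<^sup>2 + (x $ 3)\<^sup>2"
  have "root 4 A = sqrt (sqrt A)"
    using real_root_mult_exp[of 2 2 A] by (simp add: sqrt_def)
  moreover have "A \<ge> 0"
    by (simp add: A_def)
  ultimately show ?thesis
    by (simp add: gauge_norm_def A_def cmod_def)
qed

lemma gauge_norm_nonneg: "0 \<le> gauge_norm x"
  by (simp add: gauge_norm_def)

text \<open>The squared horizontal length is the real part of the complex number whose modulus is
  the squared gauge.\<close>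

lemma gauge_norm_horizontal_le: "sqrt ((x $ 1)\<^sup>2 + (x $ 2)\<^sup>2) \<le> gauge_norm x"
proof (rule real_le_lsqrt)
  show "(x $ 1)\<^sup>2 + (x $ 2)\<^sup>2 \<le> (gauge_norm x)\<^sup>2"
    using complex_Re_le_cmod[of "Complex ((x $ 1)\<^sup>2 + (x $ 2)\<^sup>2) (x $ 3)"]
    by (simp add: gauge_norm_power2)
qed (rule gauge_norm_nonneg)

lemma gauge_norm_hmult_le: "gauge_norm (hmult x y) \<le> gauge_norm x + gauge_norm y"
proof (rule power2_le_imp_le)
  define r where "r = sqrt ((x $ 1)\<^sup>2 + (x $ 2)\<^sup>2)"
  define s where "s = sqrt ((y $ 1)\<^sup>2 + (y $ 2)\<^sup>2)"
  define p where "p = x $ 1 * y $ 1 + x $ 2 * y $ 2"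
  define q where "q = x $ 1 * y $ 2 - x $ 2 * y $ 1"
  have "cmod (Complex (2 * p) q) \<le> 2 * (r * s)"
  proof -
    have "(2 * p)\<^sup>2 + q\<^sup>2 \<le> 4 * (p\<^sup>2 + q\<^sup>2)"
      by simp
    \<comment> \<open>Lagrange's identity: \<open>p + i q\<close> is the product of the conjugate of
      \<open>x1 + i x2\<close> with \<open>y1 + i y2\<close>.\<close>
    also have "p\<^sup>2 + q\<^sup>2 = (r * s)\<^sup>2"
      by (simp add: p_def q_def r_def s_def power_mult_distrib)
         (simp add: power2_eq_square algebra_simps)
    finally have "(2 * p)\<^sup>2 + q\<^sup>2 \<le> (2 * (r * s))\<^sup>2"
      by (simp add: power_mult_distrib)
    then show ?thesis
      unfolding cmod_def by (intro real_le_lsqrt) (auto simp: r_def s_def)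
  qed
  also have "r * s \<le> gauge_norm x * gauge_norm y"
    unfolding r_def s_def
    by (intro mult_mono gauge_norm_horizontal_le gauge_norm_nonneg) auto
  finally have cross: "cmod (Complex (2 * p) q) \<le> 2 * (gauge_norm x * gauge_norm y)"
    by simp
  have "(gauge_norm (hmult x y))\<^sup>2 =
      cmod (Complex ((x $ 1)\<^sup>2 + (x $ 2)\<^sup>2) (x $ 3) + Complex ((y $ 1)\<^sup>2 + (y $ 2)\<^sup>2) (y $ 3)
            + Complex (2 * p) q)"
    unfolding gauge_norm_power2
    by (rule arg_cong[of _ _ cmod])
       (simp add: hmult_def complex_eq_iff p_def q_def power2_eq_square algebra_simps)
  also have "\<dots> \<le> (gauge_norm x)\<^sup>2 + (gauge_norm y)\<^sup>2 + cmod (Complex (2 * p) q)"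
    unfolding gauge_norm_power2 by (meson add_right_mono norm_triangle_ineq order_trans)
  also have "\<dots> \<le> (gauge_norm x + gauge_norm y)\<^sup>2"
    using cross by (simp add: power2_sum)
  finally show "(gauge_norm (hmult x y))\<^sup>2 \<le> (gauge_norm x + gauge_norm y)\<^sup>2" .
qed (simp add: gauge_norm_nonneg)

section \<open>The gauge distance and the Lipschitz bound for the coefficient\<close>

lemma hdist_triangle: "hdist x z \<le> hdist x y + hdist y z"
proof -
  have "hmult (hinv x) z = hmult (hmult (hinv x) y) (hmult (hinv y) z)"
    by (metis hmult_assoc hmult_hinv(2) hmult_zero(1))
  then show ?thesis
    unfolding hdist_def by (metis gauge_norm_hmult_le)
qed

text \<open>The two group elements are inverse to each other, hence coordinatewise negatives, and
  the gauge is even in each coordinate.\<close>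

lemma hdist_commute: "hdist x y = hdist y x"
proof -
  have "(hmult (hinv x) y) $ i = - (hmult (hinv y) x) $ i" for i
    using exhaust_3[of i] by (auto simp: hmult_def hinv_def)
  then show ?thesis
    by (simp add: hdist_def gauge_norm_def)
qed

lemma hlipschitz_hdist: "hlipschitz 1 (hdist p)"
  unfolding hlipschitz_def
proof (intro allI)
  fix x y
  show "\<bar>hdist p x - hdist p y\<bar> \<le> 1 * hdist x y"
    using hdist_triangle[of p x y] hdist_triangle[of p y x] hdist_commute[of x y] by linarith
qed

text \<open>Seen as a distance to a fixed point, the coefficient is 1-Lipschitz by the reverse
  triangle inequality.\<close>

lemma coeff_a_eq_hdist: "coeff_a t = hdist (vector [t, 0, 0])"
  by (simp add: coeff_a_def hdist_def fun_eq_iff)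

lemma coeff_a_eq:
  "coeff_a t x = root 4 (((x $ 1 - t)\<^sup>2 + (x $ 2)\<^sup>2)\<^sup>2 + (x $ 3 - t * x $ 2)\<^sup>2)"
  by (simp add: coeff_a_def gauge_norm_def hmult_def hinv_def algebra_simps)

section \<open>The monotone Picard iteration\<close>

text \<open>This is the value of \<open>coeff_a t\<close> at the point
  \<open>(t, y, t * y - u)\<close>, which does not depend on \<open>t\<close>.\<close>

definition rate :: "real \<Rightarrow> real \<Rightarrow> real" where
  "rate y u = root 4 (y ^ 4 + u\<^sup>2)"

text \<open>The equation \<open>u' = 2 * y\<close> with \<open>u 0 = 0\<close> is solved by
  integration and substituted, so that the operator acts on \<open>y\<close> alone.\<close>

definition picard :: "(real \<Rightarrow> real) \<Rightarrow> real \<Rightarrow> real" where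
  "picard y t = integral {0..t} (\<lambda>s. rate (y s) (2 * integral {0..s} y))"

lemma rate_nonneg: "0 \<le> rate y u"
  by (simp add: rate_def)

lemma rate_mono:
  assumes "0 \<le> y" "y \<le> y'" "0 \<le> u" "u \<le> u'"
  shows "rate y u \<le> rate y' u'"
  unfolding rate_def using assms by (intro real_root_le_mono add_mono power_mono) auto

lemma continuous_on_picard_integrand:
  fixes y :: "real \<Rightarrow> real"
  assumes "continuous_on {0..T} y"
  shows "continuous_on {0..T} (\<lambda>s. rate (y s) (2 * integral {0..s} y))"
  unfolding rate_def
  by (intro continuous_intros assms indefinite_integral_continuous_1
        integrable_continuous_interval)

lemma picard_integrand_integrable:
  fixes y :: "real \<Rightarrow> real"
  assumes "continuous_on {0..T} y" "t \<le> T"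
  shows "(\<lambda>s. rate (y s) (2 * integral {0..s} y)) integrable_on {0..t}"
  using assms
  by (intro integrable_continuous_interval
        continuous_on_subset[OF continuous_on_picard_integrand]) auto

lemma continuous_on_picard:
  assumes "continuous_on {0..T} y"
  shows "continuous_on {0..T} (picard y)"
  unfolding picard_def[abs_def]
  by (intro indefinite_integral_continuous_1 picard_integrand_integrable[OF assms]) simp

lemma integral_initial_mono:
  fixes y y' :: "real \<Rightarrow> real"
  assumes "continuous_on {0..T} y" "continuous_on {0..T} y'" "s \<le> T"
    and "\<And>r. r \<in> {0..T} \<Longrightarrow> y r \<le> y' r"
  shows "integral {0..s} y \<le> integral {0..s} y'"
  using assms
  by (intro integral_le integrable_continuous_interval) (auto intro: continuous_on_subset)

text \<open>Nonnegativity of the smaller function keeps both arguments of \<open>rate\<close> in the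
  quadrant where \<open>rate\<close> is increasing.\<close>

lemma picard_mono:
  assumes y: "continuous_on {0..T} y" and y': "continuous_on {0..T} y'" and "t \<le> T"
    and nn: "\<And>r. r \<in> {0..T} \<Longrightarrow> 0 \<le> y r" and le: "\<And>r. r \<in> {0..T} \<Longrightarrow> y r \<le> y' r"
  shows "picard y t \<le> picard y' t"
  unfolding picard_def
proof (intro integral_le picard_integrand_integrable[where T = T] assms)
  fix s assume "s \<in> {0..t}"
  then have s: "s \<in> {0..T}"
    using \<open>t \<le> T\<close> by auto
  have "0 \<le> integral {0..s} y"
    using s nn integral_initial_mono[of T "\<lambda>_. 0" y s] y by simp
  moreover have "integral {0..s} y \<le> integral {0..s} y'"
    using s le integral_initial_mono[of T y y' s] y y' by simp
  ultimately show "rate (y s) (2 * integral {0..s} y) \<le> rate (y' s) (2 * integral {0..s} y')"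
    using s nn le by (intro rate_mono) auto
qed

section \<open>Sub- and supersolution, and the iteration between them\<close>

lemma integral_monomial:
  assumes "0 \<le> t"
  shows "integral {0..t} (\<lambda>s. c * s ^ n) = c * t ^ Suc n / real (Suc n)"
proof (rule integral_unique)
  have "((\<lambda>s. c * s ^ Suc n / real (Suc n)) has_real_derivative c * s ^ n) (at s within {0..t})" for s
    by (auto intro!: derivative_eq_intros simp del: power_Suc of_nat_Suc)
  then have "((\<lambda>s. c * s ^ n) has_integral c * t ^ Suc n / real (Suc n) - c * 0 ^ Suc n / real (Suc n))
      {0..t}"
    using assms
    by (intro fundamental_theorem_of_calculus)
       (auto simp: has_real_derivative_iff_has_vector_derivative)
  then show "((\<lambda>s. c * s ^ n) has_integral c * t ^ Suc n / real (Suc n)) {0..t}"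
    by simp
qed

lemma has_integral_exp_double:
  fixes t :: real
  assumes "0 \<le> t"
  shows "((\<lambda>s. 2 * exp (2 * s)) has_integral exp (2 * t) - 1) {0..t}"
proof -
  have "((\<lambda>s. 2 * exp (2 * s)) has_integral exp (2 * t) - exp (2 * 0)) {0..t}"
    using assms
    by (intro fundamental_theorem_of_calculus)
       (auto intro!: derivative_eq_intros
          simp: has_real_derivative_iff_has_vector_derivative[symmetric])
  then show ?thesis
    by simp
qed

text \<open>Dropping \<open>y ^ 4\<close> leaves \<open>rate y u \<ge> sqrt u\<close>. For
  \<open>y = c * t ^ 3\<close> one has \<open>u = c * t ^ 4 / 2\<close>, and the integral of
  \<open>sqrt u\<close> is again \<open>c * t ^ 3\<close> exactly when
  \<open>sqrt (c / 2) / 3 = c\<close>, that is, \<open>c = 1 / 18\<close>.\<close>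

lemma picard_subsolution:
  assumes "0 \<le> t"
  shows "t ^ 3 / 18 \<le> picard (\<lambda>s. s ^ 3 / 18) t"
proof -
  have "t ^ 3 / 18 = integral {0..t} (\<lambda>s. (1 / 6) * s ^ 2)"
    using integral_monomial[OF assms, of "1/6" 2] by (simp add: eval_nat_numeral)
  also have "\<dots> \<le> picard (\<lambda>s. s ^ 3 / 18) t"
    unfolding picard_def
  proof (intro integral_le picard_integrand_integrable[where T = t])
    fix s assume s: "s \<in> {0..t}"
    have "2 * integral {0..s} (\<lambda>r. r ^ 3 / 18) = s ^ 4 / 36"
      using integral_monomial[of s "1/18" 3] s by (simp add: eval_nat_numeral)
    moreover have "root 4 ((s ^ 4 / 36)\<^sup>2) \<le> rate (s ^ 3 / 18) (s ^ 4 / 36)"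
      unfolding rate_def by (intro real_root_le_mono) auto
    moreover have "(1 / 6) * s ^ 2 = root 4 (((1 / 6) * s ^ 2) ^ 4)"
      by (rule real_root_power_cancel[symmetric]) auto
    moreover have "((1 / 6) * s ^ 2) ^ 4 = (s ^ 4 / 36)\<^sup>2"
      by (simp add: power_mult_distrib power_divide flip: power_mult)
    ultimately show
      "(1 / 6) * s ^ 2 \<le> rate (s ^ 3 / 18) (2 * integral {0..s} (\<lambda>r. r ^ 3 / 18))"
      by metis
  qed (auto intro!: integrable_continuous_interval continuous_intros)
  finally show ?thesis .
qed

text \<open>The integral term is \<open>e - 1 \<le> e\<close> with \<open>e = exp (2 * s)\<close>.
  Since \<open>e \<ge> 1\<close>, the square is absorbed by the fourth power, and the bound
  \<open>2 * e\<close> is the derivative of the supersolution.\<close>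

lemma rate_exp_le:
  fixes s :: real
  assumes "0 \<le> s"
  shows "rate (exp (2 * s)) (2 * integral {0..s} (\<lambda>r. exp (2 * r))) \<le> 2 * exp (2 * s)"
proof -
  define e where "e = exp (2 * s)"
  have e: "1 \<le> e"
    using assms by (simp add: e_def)
  have "2 * integral {0..s} (\<lambda>r. exp (2 * r)) = e - 1"
    using integral_unique[OF has_integral_exp_double[OF assms]] by (simp add: e_def)
  moreover have "rate e (e - 1) \<le> rate e e"
    using e by (intro rate_mono) auto
  moreover have "rate e e \<le> root 4 ((2 * e) ^ 4)"
  proof -
    have "e\<^sup>2 \<le> e ^ 4"
      using e by (intro power_increasing) auto
    moreover have "0 \<le> e ^ 4"
      by simp
    ultimately have "e\<^sup>2 \<le> 15 * e ^ 4"
      by linarith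
    then have "e ^ 4 + e\<^sup>2 \<le> (2 * e) ^ 4"
      by (simp add: power_mult_distrib)
    then show ?thesis
      by (simp add: rate_def)
  qed
  moreover have "root 4 ((2 * e) ^ 4) = 2 * e"
    using e by (intro real_root_power_cancel) auto
  ultimately show ?thesis
    by (simp add: e_def)
qed

lemma picard_supersolution:
  assumes "0 \<le> t"
  shows "picard (\<lambda>s. exp (2 * s)) t \<le> exp (2 * t)"
proof -
  have "picard (\<lambda>s. exp (2 * s)) t \<le> integral {0..t} (\<lambda>s. 2 * exp (2 * s))"
    unfolding picard_def
    by (intro integral_le picard_integrand_integrable[where T = t] rate_exp_le)
       (auto intro!: integrable_continuous_interval continuous_intros)
  also have "\<dots> = exp (2 * t) - 1"
    by (rule integral_unique[OF has_integral_exp_double[OF assms]])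
  finally show ?thesis
    by simp
qed

lemma subsolution_le_supersolution:
  fixes t :: real
  assumes "0 \<le> t"
  shows "t ^ 3 / 18 \<le> exp (2 * t)"
proof -
  \<comment> \<open>The cube of \<open>exp (2 * t / 3)\<close> is \<open>exp (2 * t)\<close>, so the
    linear bound \<open>x \<le> exp x\<close> at \<open>x = 2 * t / 3\<close> suffices.\<close>
  have "t ^ 3 / 18 \<le> (2 * t / 3) ^ 3"
    using assms by (simp add: power_divide power_mult_distrib)
  also have "\<dots> \<le> exp (2 * t / 3) ^ 3"
    using assms exp_ge_add_one_self[of "2 * t / 3"] by (intro power_mono) linarith+
  also have "\<dots> = exp (2 * t)"
    by (simp flip: exp_of_nat_mult)
  finally show ?thesis .
qed

text \<open>The starting function must not be zero: zero is itself a fixed point of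
  \<open>picard\<close> and would only give back the line.\<close>

definition iter :: "nat \<Rightarrow> real \<Rightarrow> real" where
  "iter n = (picard ^^ n) (\<lambda>t. t ^ 3 / 18)"

lemma iter_Suc: "iter (Suc n) = picard (iter n)"
  by (simp add: iter_def)

lemma continuous_on_iter: "continuous_on {0..T} (iter n)"
proof (induction n)
  case 0
  show ?case
    by (auto simp: iter_def intro!: continuous_intros)
qed (auto simp: iter_Suc intro: continuous_on_picard)

text \<open>Both claims go through one induction, since \<open>picard_mono\<close> asks for a
  nonnegative smaller function. The time stays arbitrary because \<open>picard\<close> looks back
  over all of \<open>{0..t}\<close>.\<close>

lemma iter_le_Suc: "0 \<le> t \<Longrightarrow> 0 \<le> iter n t \<and> iter n t \<le> iter (Suc n) t"
proof (induction n arbitrary: t)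
  case 0
  then show ?case
    using picard_subsolution by (simp add: iter_def)
next
  case (Suc n)
  then have "iter (Suc n) t \<le> iter (Suc (Suc n)) t"
    unfolding iter_Suc[of "Suc n"] iter_Suc[of n]
    by (intro picard_mono[where T = t] continuous_on_picard continuous_on_iter)
       (auto simp flip: iter_Suc)
  then show ?case
    using Suc by (meson order_trans)
qed

lemma iter_nonneg: "0 \<le> t \<Longrightarrow> 0 \<le> iter n t"
  using iter_le_Suc by blast

lemma incseq_iter: "0 \<le> t \<Longrightarrow> incseq (\<lambda>n. iter n t)"
  using iter_le_Suc by (auto intro: incseq_SucI)

lemma iter_le_exp: "0 \<le> t \<Longrightarrow> iter n t \<le> exp (2 * t)"
proof (induction n arbitrary: t)
  case 0
  then show ?case
    using subsolution_le_supersolution by (simp add: iter_def)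
next
  case (Suc n)
  have "picard (iter n) t \<le> picard (\<lambda>s. exp (2 * s)) t"
    using Suc
    by (intro picard_mono[where T = t] continuous_on_iter)
       (auto intro!: continuous_intros intro: iter_nonneg)
  then show ?case
    using picard_supersolution[OF Suc.prems] by (simp add: iter_Suc)
qed

lemma integral_iter_bounds:
  assumes "0 \<le> t"
  shows "0 \<le> integral {0..t} (iter n)" "integral {0..t} (iter n) \<le> integral {0..t} (\<lambda>r. exp (2 * r))"
proof -
  show "0 \<le> integral {0..t} (iter n)"
    using assms continuous_on_iter iter_nonneg
    by (intro integral_nonneg integrable_continuous_interval) auto
  show "integral {0..t} (iter n) \<le> integral {0..t} (\<lambda>r. exp (2 * r))"
    using assms iter_le_exp
    by (intro integral_initial_mono[where T = t] continuous_on_iter) (auto intro!: continuous_intros)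
qed

text \<open>The increasing iterates, bounded by \<open>exp (2 * t)\<close>, converge pointwise.
  Dominated convergence carries the limit first through the inner integral of \<open>picard\<close>,
  then through the outer one.\<close>

lemma ex_picard_fixed_point:
  obtains y where "\<And>t. 0 \<le> t \<Longrightarrow> t ^ 3 / 18 \<le> y t"
    "\<And>T. continuous_on {0..T} y" "\<And>t. 0 \<le> t \<Longrightarrow> y t = picard y t"
proof -
  define y where "y t = lim (\<lambda>n. iter n t)" for t
  have lim: "(\<lambda>n. iter n t) \<longlonglongrightarrow> y t" if "0 \<le> t" for t
  proof -
    obtain L where "(\<lambda>n. iter n t) \<longlonglongrightarrow> L"
      using incseq_convergent[OF incseq_iter, of t "exp (2 * t)"] iter_le_exp \<open>0 \<le> t\<close> by blast
    then show ?thesis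
      by (simp add: y_def limI)
  qed
  have int_lim: "(\<lambda>n. integral {0..t} (iter n)) \<longlonglongrightarrow> integral {0..t} y" for t
  proof (rule dominated_convergence(2)[where h = "\<lambda>s. exp (2 * s)"])
    show "norm (iter n s) \<le> exp (2 * s)" if "s \<in> {0..t}" for n s
      using that iter_nonneg iter_le_exp by simp
  qed (auto intro!: integrable_continuous_interval continuous_intros continuous_on_iter lim)
  have bound: "norm (rate (iter n s) (2 * integral {0..s} (iter n))) \<le> 2 * exp (2 * s)"
    if "s \<in> {0..t}" for n s t
  proof -
    have "rate (iter n s) (2 * integral {0..s} (iter n))
        \<le> rate (exp (2 * s)) (2 * integral {0..s} (\<lambda>r. exp (2 * r)))"
      using that integral_iter_bounds[of s n] iter_nonneg[of s n] iter_le_exp[of s n]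
      by (intro rate_mono) auto
    also have "\<dots> \<le> 2 * exp (2 * s)"
      using that by (intro rate_exp_le) auto
    finally show ?thesis
      by (simp add: rate_nonneg)
  qed
  have integrable: "(\<lambda>s. 2 * exp (2 * s)) integrable_on {0..t}" for t :: real
    by (intro integrable_continuous_interval continuous_intros)
  have rate_lim: "(\<lambda>n. rate (iter n s) (2 * integral {0..s} (iter n)))
      \<longlonglongrightarrow> rate (y s) (2 * integral {0..s} y)" if "s \<in> {0..t}" for s t
    unfolding rate_def using that by (intro tendsto_intros lim int_lim) auto
  note dominated = picard_integrand_integrable[OF continuous_on_iter order_refl] integrable bound rate_lim
  have picard_lim: "(\<lambda>n. picard (iter n) t) \<longlonglongrightarrow> picard y t" for t
    unfolding picard_def by (rule dominated_convergence(2)[OF dominated])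
  \<comment> \<open>Continuity of the limit \<open>y\<close> is not yet known, so integrability is
    taken from dominated convergence as well.\<close>
  have picard_integrable: "(\<lambda>s. rate (y s) (2 * integral {0..s} y)) integrable_on {0..t}" for t
    by (rule dominated_convergence(1)[OF dominated])
  have fixpt: "y t = picard y t" if "0 \<le> t" for t
    using LIMSEQ_unique[OF LIMSEQ_Suc[OF lim[OF that]]] picard_lim[of t] by (simp add: iter_Suc)
  \<comment> \<open>Pointwise convergence alone gives no continuity; it comes from the fixed point
    equation, since \<open>picard y\<close> is an indefinite integral.\<close>
  have "continuous_on {0..T} (picard y)" for T
    unfolding picard_def[abs_def] by (intro indefinite_integral_continuous_1 picard_integrable)
  then have "continuous_on {0..T} y" for T
    using fixpt by (metis (mono_tags, lifting) atLeastAtMost_iff continuous_on_cong)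
  moreover have "t ^ 3 / 18 \<le> y t" if "0 \<le> t" for t
    using incseq_le[OF incseq_iter[OF that] lim[OF that], of 0] by (simp add: iter_def)
  ultimately show ?thesis
    using fixpt that by blast
qed

section \<open>Solutions of the Cauchy problem\<close>

lemma field_b_eq: "field_b t x = vector [1, coeff_a t x, coeff_a t x * x $ 1 - x $ 2]"
  by (simp add: field_b_def X1_def X2_def vec_eq_iff forall_3)

text \<open>Written as a combination of constant vectors, a curve inherits continuity and
  derivatives from its scalar coordinates.\<close>

lemma vector3_eq_combination:
  "(vector [a, b, c] :: real ^ 3)
    = a *\<^sub>R vector [1, 0, 0] + b *\<^sub>R vector [0, 1, 0] + c *\<^sub>R vector [0, 0, 1]"
  by (simp add: vec_eq_iff forall_3)

lemma continuous_on_vector3: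
  fixes f g h :: "real \<Rightarrow> real"
  assumes "continuous_on S f" "continuous_on S g" "continuous_on S h"
  shows "continuous_on S (\<lambda>t. vector [f t, g t, h t] :: real ^ 3)"
  unfolding vector3_eq_combination[of "f _"] by (intro continuous_intros assms)

lemma has_vector_derivative_vector3:
  fixes f g h :: "real \<Rightarrow> real"
  assumes "(f has_real_derivative f') (at t within S)" "(g has_real_derivative g') (at t within S)"
    "(h has_real_derivative h') (at t within S)"
  shows "((\<lambda>t. vector [f t, g t, h t] :: real ^ 3) has_vector_derivative vector [f', g', h'])
    (at t within S)"
  unfolding vector3_eq_combination[of "f _"] vector3_eq_combination[of f'] using assms
  by (auto intro!: derivative_eq_intros)

text \<open>A classical solution satisfies the integral equation by the fundamental theorem of
  calculus; continuity of the right-hand side supplies absolute integrability.\<close>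

lemma is_solution_if_has_vector_derivative:
  assumes d: "\<And>t. t \<in> {0..T} \<Longrightarrow> (\<gamma> has_vector_derivative b t (\<gamma> t)) (at t within {0..T})"
    and c: "continuous_on {0..T} (\<lambda>t. b t (\<gamma> t))"
  shows "is_solution T b \<gamma>"
  unfolding is_solution_def
proof (intro conjI ballI)
  show "continuous_on {0..T} \<gamma>"
    unfolding continuous_on_eq_continuous_within
    by (blast intro: has_vector_derivative_continuous d)
  show "(\<lambda>s. b s (\<gamma> s)) absolutely_integrable_on {0..T}"
    by (rule absolutely_integrable_continuous_real[OF c])
  fix t assume t: "t \<in> {0..T}"
  then have "((\<lambda>s. b s (\<gamma> s)) has_integral \<gamma> t - \<gamma> 0) {0..t}"
    by (intro fundamental_theorem_of_calculus)
       (auto intro: has_vector_derivative_within_subset[OF d])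
  then show "\<gamma> t = \<gamma> 0 + integral {0..t} (\<lambda>s. b s (\<gamma> s))"
    by (simp add: integral_unique)
qed

text \<open>The third coordinate \<open>t * y - u\<close> has derivative
  \<open>y + t * rate y u - 2 * y = t * rate y u - y\<close>, which is the third component of the
  field on the curve. Both the line and the second solution arise in this way.\<close>

lemma is_solution_of_autonomous_system:
  assumes y: "\<And>t. t \<in> {0..T} \<Longrightarrow> (y has_real_derivative rate (y t) (u t)) (at t within {0..T})"
    and u: "\<And>t. t \<in> {0..T} \<Longrightarrow> (u has_real_derivative 2 * y t) (at t within {0..T})"
  shows "is_solution T field_b (\<lambda>t. vector [t, y t, t * y t - u t])"
proof (rule is_solution_if_has_vector_derivative)
  have b: "field_b t (vector [t, y t, t * y t - u t])
      = vector [1, rate (y t) (u t), t * rate (y t) (u t) - y t]" for t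
    by (simp add: field_b_eq coeff_a_eq rate_def mult.commute flip: power_mult)
  show "((\<lambda>t. vector [t, y t, t * y t - u t]) has_vector_derivative
      field_b t (vector [t, y t, t * y t - u t])) (at t within {0..T})" if "t \<in> {0..T}" for t
    unfolding b
    by (rule has_vector_derivative_vector3)
       (auto intro!: derivative_eq_intros y u that)
  have "continuous_on {0..T} y" "continuous_on {0..T} u"
    by (rule DERIV_continuous_on[OF y] DERIV_continuous_on[OF u], assumption)+
  then show "continuous_on {0..T} (\<lambda>t. field_b t (vector [t, y t, t * y t - u t]))"
    unfolding b rate_def by (intro continuous_on_vector3 continuous_intros)
qed

lemma vector3_zero: "(vector [0, 0, 0] :: real ^ 3) = 0"
  by (simp add: vec_eq_iff forall_3)

theorem mainTheorem4:
  fixes T :: real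
  assumes "T > 0"
  shows "(\<forall>t\<in>{0..T}. \<forall>x.
            coeff_a t x = root 4 ((\<bar>x $ 1 - t\<bar>\<^sup>2 + \<bar>x $ 2\<bar>\<^sup>2)\<^sup>2 + \<bar>x $ 3 - t * x $ 2\<bar>\<^sup>2))
       \<and> (\<forall>t\<in>{0..T}. hlipschitz 1 (coeff_a t))
       \<and> lipschitz_horizontal_field T field_b
       \<and> cauchy_solution T field_b 0 (\<lambda>t. vector [t, 0, 0])
       \<and> (\<exists>\<gamma>. cauchy_solution T field_b 0 \<gamma>
              \<and> (\<exists>t\<in>{0..T}. \<gamma> t \<noteq> vector [t, 0, 0]))"
proof (intro conjI)
  show "\<forall>t\<in>{0..T}. \<forall>x.
      coeff_a t x = root 4 ((\<bar>x $ 1 - t\<bar>\<^sup>2 + \<bar>x $ 2\<bar>\<^sup>2)\<^sup>2 + \<bar>x $ 3 - t * x $ 2\<bar>\<^sup>2)"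
    by (simp add: coeff_a_eq)
  show lip: "\<forall>t\<in>{0..T}. hlipschitz 1 (coeff_a t)"
    by (simp add: coeff_a_eq_hdist hlipschitz_hdist)
  have "hlipschitz 1 (\<lambda>_. 1)"
    by (simp add: hlipschitz_def hdist_def gauge_norm_nonneg)
  then show "lipschitz_horizontal_field T field_b"
    unfolding lipschitz_horizontal_field_def using lip
    by (intro exI[of _ "\<lambda>_ _. 1"] exI[of _ coeff_a] exI[of _ 1]) (simp add: field_b_def)
  \<comment> \<open>The line is the trivial solution \<open>y = u = 0\<close> of the system, as
    \<open>rate 0 0 = 0\<close>.\<close>
  show "cauchy_solution T field_b 0 (\<lambda>t. vector [t, 0, 0])"
    using is_solution_of_autonomous_system[of T "\<lambda>_. 0" "\<lambda>_. 0"]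
    by (simp add: cauchy_solution_def vector3_zero rate_def)
  show "\<exists>\<gamma>. cauchy_solution T field_b 0 \<gamma> \<and> (\<exists>t\<in>{0..T}. \<gamma> t \<noteq> vector [t, 0, 0])"
  proof -
    obtain y where lower: "\<And>t. 0 \<le> t \<Longrightarrow> t ^ 3 / 18 \<le> y t"
      and cont: "\<And>T. continuous_on {0..T} y" and fixpt: "\<And>t. 0 \<le> t \<Longrightarrow> y t = picard y t"
      using ex_picard_fixed_point by blast
    define u where "u t = 2 * integral {0..t} y" for t
    define \<gamma> :: "real \<Rightarrow> heis" where "\<gamma> t = vector [t, y t, t * y t - u t]" for t
    \<comment> \<open>The derivative is computed for \<open>picard y\<close>, an integral of a
      continuous function, and then passed to \<open>y\<close>, which agrees with it on
      \<open>{0..T}\<close>.\<close>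
    have deriv: "(picard y has_real_derivative rate (y t) (u t)) (at t within {0..T})"
      if "t \<in> {0..T}" for t
      using integral_has_real_derivative[OF continuous_on_picard_integrand[OF cont] that]
      by (simp add: picard_def[abs_def] u_def)
    have "(y has_real_derivative rate (y t) (u t)) (at t within {0..T})"
      if "t \<in> {0..T}" for t
      using has_field_derivative_transform_within[OF deriv[OF that] zero_less_one that, of y] fixpt
      by simp
    moreover have "(u has_real_derivative 2 * y t) (at t within {0..T})" if "t \<in> {0..T}" for t
      unfolding u_def[abs_def]
      by (intro DERIV_cmult integral_has_real_derivative[OF cont that])
    ultimately have "is_solution T field_b \<gamma>"
      unfolding \<gamma>_def[abs_def] by (rule is_solution_of_autonomous_system)
    moreover have "\<gamma> 0 = 0"
      using fixpt[of 0] by (simp add: \<gamma>_def u_def picard_def vector3_zero)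
    \<comment> \<open>The curves are separated at the endpoint, where the lower barrier gives
      \<open>y T \<ge> T ^ 3 / 18 > 0\<close>.\<close>
    moreover have "\<gamma> T \<noteq> vector [T, 0, 0]"
    proof
      assume "\<gamma> T = vector [T, 0, 0]"
      then have "\<gamma> T $ 2 = (vector [T, 0, 0] :: heis) $ 2"
        by simp
      then have "y T = 0"
        by (simp add: \<gamma>_def)
      then show False
        using lower[of T] \<open>T > 0\<close> by simp
    qed
    ultimately show ?thesis
      using \<open>T > 0\<close> by (auto simp: cauchy_solution_def intro!: exI[of _ \<gamma>] bexI[of _ T])
  qed
qed

end
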